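(* Let $f\colon \mathbb{S}^{n\times n}\to\mathbb{R}$ be twice continuously differentiable and concave. Let $Y\in\mathrm{St}(d,p)^m$ be a second-order critical point of $(\mathrm{RP}_p)$, let $X=YY^\top$, let $\mathcal{F}_X$ be the face of $\mathcal{C}$ containing $X$ in its relative interior, and let $S=S(X)$. If $Y$ is rank-deficient ($\operatorname{rank}(Y)<p$), then $S\succeq 0$. If $Y$ has full rank $p$, then $S$ has at most $$\left\lfloor\frac{\dim\mathcal{F}_X-\Delta}{p}\right\rfloor$$ negative eigenvalues (counted with multiplicity). Hence, if $X$ is not a KKT point of $(\mathrm{P})$, then $\operatorname{rank}(X)=p$ and $\dim\mathcal{F}_X\ge\Delta+p$.
   Context: Integers satisfy $m\ge 1$, $1\le d\le p\le n=md$. $\mathbb{S}^{k\times k}$ is the space of real symmetric $k\times k$ matrices. Matrices $M\in\mathbb{R}^{n\times n}$ are viewed as $m\times m$ block matrices with blocks $M_{ij}\in\mathbb{R}^{d\times d}$; $Y\in\mathbb{R}^{n\times p}$ is viewed as a stack of slices $Y_1,\dots,Y_m\in\mathbb{R}^{d\times p}$. Inner product: $\langle A,B\rangle=\operatorname{trace}(A^\top B)$. $\nabla f(X)\in\mathbb{S}^{n\times n}$ and $\nabla^2 f(X)$ are the Euclidean gradient and Hessian operator of $f$ on $\mathbb{S}^{n\times n}$. Define $\mathrm{St}(d,p)^m=\{Y\in\mathbb{R}^{n\times p}: Y_iY_i^\top=I_d,\ i=1,\dots,m\}$ and $\mathcal{C}=\{X\in\mathbb{S}^{n\times n}: X\succeq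 0,\ X_{ii}=I_d,\ i=1,\dots,m\}$. Problem $(\mathrm{P})$: minimize $f(X)$ over $X\in\mathcal{C}$. Problem $(\mathrm{RP}_p)$: minimize $g(Y)=f(YY^\top)$ over $Y\in\mathrm{St}(d,p)^m$. $\operatorname{symblockdiag}(M)$ is the matrix with diagonal blocks $(M_{ii}+M_{ii}^\top)/2$ and all other blocks zero. For $X\in\mathcal{C}$, $S(X)=\nabla f(X)-\operatorname{symblockdiag}(\nabla f(X)X)$. The tangent space is $\mathrm{T}_Y\mathrm{St}(d,p)^m=\{\dot Y\in\mathbb{R}^{n\times p}:\operatorname{symblockdiag}(\dot YY^\top+Y\dot Y^\top)=0\}$. With $X=YY^\top$, $Y\in\mathrm{St}(d,p)^m$ is a critical point of $(\mathrm{RP}_p)$ if the Riemannian gradient of $g$ vanishes, i.e. $S(X)Y=0$. It is a second-order critical point if moreover the Riemannian Hessian is positive semidefinite, i.e. $\langle\dot Y,\nabla^2 g(Y)[\dot Y]-\operatorname{symblockdiag}(\nabla g(Y)Y^\top)\dot Y\rangle\ge 0$ for all $\dot Y\in\mathrm{T}_Y\mathrm{St}(d,p)^m$, where $\nabla g(Y)=2\nabla f(X)Y$ and $\nabla^2g(Y)[\dot Y]=2(\nabla^2f(X)[\dot X]Y+\nabla f(X)\dot Y)$ with $\dot X=\dot YY^\top+Y\dot Y^\top$. $X\in\mathcal{C}$ is a KKT point of $(\mathrm{P})$ if there exist $\hat S\in\mathbb{S}^{n\times n}$ and a symmetric block-diagonal (with $d\times d$ blocks) $\hat\Lambda\in\mathbb{S}^{n\times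 n}$ such that $\hat SX=0$, $\hat S=\nabla f(X)+\hat\Lambda$ and $\hat S\succeq 0$. A face of $\mathcal{C}$ is a convex subset $\mathcal{F}\subseteq\mathcal{C}$ such that every closed line segment in $\mathcal{C}$ with a relative interior point in $\mathcal{F}$ has both endpoints in $\mathcal{F}$. For $X\in\mathcal{C}$, $\mathcal{F}_X$ is the unique face of $\mathcal{C}$ containing $X$ in its relative interior. Explicitly, if $X=ZZ^\top$ with $Z\in\mathbb{R}^{n\times r}$, $r=\operatorname{rank}(X)$, then $\mathcal{F}_X=\{Z(I_r+A)Z^\top: A\in\mathbb{S}^{r\times r},\ Z_iAZ_i^\top=0\ (i=1,\dots,m),\ I_r+A\succeq 0\}$, and $\dim\mathcal{F}_X=\dim\{A\in\mathbb{S}^{r\times r}: Z_iAZ_i^\top=0,\ i=1,\dots,m\}$. $\Delta=\dfrac{p(p+1)}{2}-m\dfrac{d(d+1)}{2}$. *)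

theory Defs
  imports "HOL-Analysis.Analysis" "HOL-Computational_Algebra.Polynomial"
begin

text \<open>
  The integers \<open>m\<close>, \<open>d\<close>, \<open>p\<close> are the cardinalities of the finite index types \<open>'m\<close>, \<open>'d\<close>, \<open>'p\<close>.
  Rows and columns of an \<open>n \<times> n\<close> matrix, \<open>n = m d\<close>, are indexed by \<open>'m \<times> 'd\<close>: the index \<open>(i, a)\<close>
  is position \<open>a\<close> inside block \<open>i\<close>.
\<close>

text \<open>The library inner product on matrices is the trace inner product.\<close>

lemma inner_matrix_eq_trace:
  fixes A B :: "real^'q^'r"
  shows "A \<bullet> B = trace (transpose A ** B)"
proof -
  have "A \<bullet> B = (\<Sum>r\<in>UNIV. \<Sum>q\<in>UNIV. A$r$q * B$r$q)"
    by (simp add: inner_vec_def)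
  also have "\<dots> = (\<Sum>q\<in>UNIV. \<Sum>r\<in>UNIV. A$r$q * B$r$q)"
    by (rule sum.swap)
  finally show ?thesis
    by (simp add: trace_def matrix_matrix_mult_def transpose_def)
qed

definition sym_mats :: "(real^'n^'n) set" where
  "sym_mats = {M. transpose M = M}"

definition psd :: "real^'n^'n \<Rightarrow> bool" where
  "psd M \<longleftrightarrow> M \<in> sym_mats \<and> (\<forall>v. v \<bullet> (M *v v) \<ge> 0)"

definition charpoly :: "real^'n^'n \<Rightarrow> real poly" where
  "charpoly M = det ((\<chi> r s. (if r = s then [:0, 1:] else 0) - [:M$r$s:]) :: real poly^'n^'n)"

text \<open>Multiplicities are algebraic, i.e. orders of roots of the characteristic polynomial
  (which is monic, so the sum ranges over a finite set).\<close>

definition num_neg_eigenvalues :: "real^'n^'n \<Rightarrow> nat" where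
  "num_neg_eigenvalues M = (\<Sum>x | x < 0 \<and> poly (charpoly M) x = 0. order x (charpoly M))"

text \<open>
  A function on symmetric matrices is modelled by a function on all matrices of which only the
  restriction to \<^term>\<open>sym_mats\<close> is ever used; all derivatives are taken within that subspace.
  A derivative within \<^term>\<open>sym_mats\<close> is only determined on symmetric directions, which is why
  \<open>grad\<close> requires a symmetric representative and \<open>hess f X V\<close> is meaningful only for symmetric \<open>V\<close>.
\<close>

definition grad :: "(real^'n^'n \<Rightarrow> real) \<Rightarrow> real^'n^'n \<Rightarrow> real^'n^'n" where
  "grad f X = (THE G. G \<in> sym_mats \<and> (f has_derivative (\<lambda>V. G \<bullet> V)) (at X within sym_mats))"

definition hess :: "(real^'n^'n \<Rightarrow> real) \<Rightarrow> real^'n^'n \<Rightarrow> real^'n^'n \<Rightarrow> real^'n^'n" where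
  "hess f X V = frechet_derivative (grad f) (at X within sym_mats) V"

text \<open>In finite dimension, continuity of the Hessian operator is continuity of
  \<open>X \<mapsto> hess f X V\<close> for each fixed direction \<open>V\<close>.\<close>

definition twice_cont_diff_sym :: "(real^'n^'n \<Rightarrow> real) \<Rightarrow> bool" where
  "twice_cont_diff_sym f \<longleftrightarrow>
     f differentiable_on sym_mats \<and>
     grad f differentiable_on sym_mats \<and>
     (\<forall>V\<in>sym_mats. continuous_on sym_mats (\<lambda>X. hess f X V))"

definition block :: "real^('m::finite \<times> 'd::finite)^('m \<times> 'd) \<Rightarrow> 'm \<Rightarrow> 'm \<Rightarrow> real^'d^'d" where
  "block M i j = (\<chi> a b. M $ (i, a) $ (j, b))"

definition slice :: "real^'p^('m::finite \<times> 'd::finite) \<Rightarrow> 'm \<Rightarrow> real^'p^'d" where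
  "slice Y i = (\<chi> a. Y $ (i, a))"

definition stiefel :: "(real^'p^('m::finite \<times> 'd::finite)) set" where
  "stiefel = {Y. \<forall>i. slice Y i ** transpose (slice Y i) = mat 1}"

definition feasible :: "(real^('m::finite \<times> 'd::finite)^('m \<times> 'd)) set" where
  "feasible = {X. psd X \<and> (\<forall>i. block X i i = mat 1)}"

definition symblockdiag ::
  "real^('m::finite \<times> 'd::finite)^('m \<times> 'd) \<Rightarrow> real^('m \<times> 'd)^('m \<times> 'd)" where
  "symblockdiag M = (\<chi> r s. if fst r = fst s
      then ((1/2) *\<^sub>R (block M (fst r) (fst r) + transpose (block M (fst r) (fst r)))) $ snd r $ snd s
      else 0)"

definition block_diagonal :: "real^('m::finite \<times> 'd::finite)^('m \<times> 'd) \<Rightarrow> bool" where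
  "block_diagonal M \<longleftrightarrow> (\<forall>i j. i \<noteq> j \<longrightarrow> block M i j = 0)"

definition S_mat ::
  "(real^('m::finite \<times> 'd::finite)^('m \<times> 'd) \<Rightarrow> real) \<Rightarrow>
    real^('m \<times> 'd)^('m \<times> 'd) \<Rightarrow> real^('m \<times> 'd)^('m \<times> 'd)" where
  "S_mat f X = grad f X - symblockdiag (grad f X ** X)"

definition tangent_space ::
  "real^'p^('m::finite \<times> 'd::finite) \<Rightarrow> (real^'p^('m \<times> 'd)) set" where
  "tangent_space Y = {Y'. symblockdiag (Y' ** transpose Y + Y ** transpose Y') = 0}"

text \<open>Euclidean gradient and Hessian of \<open>g(Y) = f(Y Y\<^sup>T)\<close>.\<close>

definition grad_g ::
  "(real^('m::finite \<times> 'd::finite)^('m \<times> 'd) \<Rightarrow> real) \<Rightarrow>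
    real^'p^('m \<times> 'd) \<Rightarrow> real^'p^('m \<times> 'd)" where
  "grad_g f Y = 2 *\<^sub>R (grad f (Y ** transpose Y) ** Y)"

definition hess_g ::
  "(real^('m::finite \<times> 'd::finite)^('m \<times> 'd) \<Rightarrow> real) \<Rightarrow>
    real^'p^('m \<times> 'd) \<Rightarrow> real^'p^('m \<times> 'd) \<Rightarrow> real^'p^('m \<times> 'd)" where
  "hess_g f Y Y' = 2 *\<^sub>R
     (hess f (Y ** transpose Y) (Y' ** transpose Y + Y ** transpose Y') ** Y
      + grad f (Y ** transpose Y) ** Y')"

definition critical_point ::
  "(real^('m::finite \<times> 'd::finite)^('m \<times> 'd) \<Rightarrow> real) \<Rightarrow> real^'p^('m \<times> 'd) \<Rightarrow> bool" where
  "critical_point f Y \<longleftrightarrow> Y \<in> stiefel \<and> S_mat f (Y ** transpose Y) ** Y = 0"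

definition second_order_critical_point ::
  "(real^('m::finite \<times> 'd::finite)^('m \<times> 'd) \<Rightarrow> real) \<Rightarrow> real^'p^('m \<times> 'd) \<Rightarrow> bool" where
  "second_order_critical_point f Y \<longleftrightarrow> critical_point f Y \<and>
     (\<forall>Y'\<in>tangent_space Y.
        Y' \<bullet> (hess_g f Y Y' - symblockdiag (grad_g f Y ** transpose Y) ** Y') \<ge> 0)"

definition KKT_point ::
  "(real^('m::finite \<times> 'd::finite)^('m \<times> 'd) \<Rightarrow> real) \<Rightarrow> real^('m \<times> 'd)^('m \<times> 'd) \<Rightarrow> bool" where
  "KKT_point f X \<longleftrightarrow> X \<in> feasible \<and>
     (\<exists>S L. S \<in> sym_mats \<and> L \<in> sym_mats \<and> block_diagonal L \<and>
            S ** X = 0 \<and> S = grad f X + L \<and> psd S)"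

definition face_at :: "'a::euclidean_space set \<Rightarrow> 'a \<Rightarrow> 'a set" where
  "face_at C x = (THE F. F face_of C \<and> x \<in> rel_interior F)"

definition Delta :: "nat \<Rightarrow> nat \<Rightarrow> nat \<Rightarrow> real" where
  "Delta m d p = real p * (real p + 1) / 2 - real m * (real d * (real d + 1) / 2)"

end

theory Submission
  imports Defs
begin

text \<open>
  Concavity of \<open>f\<close> makes the Hessian term of the second-order condition nonpositive, so the quadratic
  form \<open>Y' \<mapsto> \<langle>Y', S Y'\<rangle>\<close> is nonnegative on the tangent space at \<open>Y\<close>. If \<open>Y v = 0\<close> with \<open>v \<noteq> 0\<close>,
  every \<open>u v\<^sup>T\<close> is tangent, so \<open>S\<close> is positive semidefinite. If \<open>Y\<close> has full rank, test with
  \<open>W + Y A\<close>, where the columns of \<open>W\<close> lie in the span of the eigenvectors of \<open>S\<close> with negative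
  eigenvalues and \<open>A\<close> is symmetric: since \<open>S Y = 0\<close>, such a matrix is tangent only if \<open>W = 0\<close> and
  the diagonal blocks of \<open>Y A Y\<^sup>T\<close> vanish. As the tangent space is cut out by at most \<open>m d (d + 1) / 2\<close>
  linear equations, rank-nullity bounds the number of negative eigenvalues; the matrices \<open>Y A Y\<^sup>T\<close>
  that remain are directions of the face of \<open>X\<close>.
\<close>

subsection \<open>Derivatives within the symmetric matrices\<close>

lemma inner_transpose_transpose:
  fixes A B :: "real^'q^'r"
  shows "transpose A \<bullet> transpose B = A \<bullet> B"
proof -
  have "transpose A \<bullet> transpose B = (\<Sum>q\<in>UNIV. \<Sum>r\<in>UNIV. A$r$q * B$r$q)"
    by (simp add: inner_vec_def transpose_def)
  also have "\<dots> = (\<Sum>r\<in>UNIV. \<Sum>q\<in>UNIV. A$r$q * B$r$q)" by (rule sum.swap)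
  finally show ?thesis by (simp add: inner_vec_def)
qed

lemma inner_matrix_mult_right:
  fixes A :: "real^'p^'n" and B :: "real^'q^'n" and C :: "real^'p^'q"
  shows "A \<bullet> (B ** C) = (transpose B ** A) \<bullet> C"
  by (simp add: inner_matrix_eq_trace matrix_transpose_mul matrix_mul_assoc)

lemma inner_matrix_mult_left:
  fixes A :: "real^'p^'n" and B :: "real^'q^'n" and C :: "real^'p^'q"
  shows "A \<bullet> (B ** C) = (A ** transpose C) \<bullet> B"
proof -
  have "A \<bullet> (B ** C) = transpose A \<bullet> (transpose C ** transpose B)"
    using inner_transpose_transpose[of A "B ** C"] by (simp add: matrix_transpose_mul)
  also have "\<dots> = transpose (A ** transpose C) \<bullet> transpose B"
    by (simp only: inner_matrix_mult_right matrix_transpose_mul)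
  finally show ?thesis by (simp only: inner_transpose_transpose)
qed

lemma transpose_add: "transpose (A + B) = transpose A + transpose (B :: real^'q^'r)"
  by (simp add: transpose_def vec_eq_iff)

lemma linear_transpose: "linear (transpose :: real^'q^'r \<Rightarrow> _)"
  by (rule linearI) (simp_all add: transpose_def vec_eq_iff)

lemma linear_matrix_mult_left: "linear (\<lambda>B. (A :: real^'q^'r) ** (B :: real^'s^'q))"
  by (rule linearI) (simp_all add: matrix_matrix_mult_def vec_eq_iff algebra_simps
      sum.distrib sum_distrib_left)

lemma linear_matrix_mult_right: "linear (\<lambda>A. (A :: real^'q^'r) ** (B :: real^'s^'q))"
  by (rule linearI) (simp_all add: matrix_matrix_mult_def vec_eq_iff algebra_simps
      sum.distrib sum_distrib_left)

lemma subspace_sym_mats: "subspace (sym_mats :: (real^'n^'n) set)"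
  by (auto simp: subspace_def sym_mats_def transpose_def vec_eq_iff)

text \<open>The line stays inside \<open>T\<close>, so a derivative within \<open>T\<close>
  restricts to an ordinary two-sided derivative of one real variable. There vector derivatives are
  unique, which fails for \<open>has_derivative\<close> within a proper subspace.\<close>

lemma has_vector_derivative_along_line:
  fixes g :: "'a::real_normed_vector \<Rightarrow> 'b::real_normed_vector"
  assumes g: "(g has_derivative g') (at (X + t *\<^sub>R V) within T)"
    and T: "subspace T" "X \<in> T" "V \<in> T"
  shows "((\<lambda>s. g (X + s *\<^sub>R V)) has_vector_derivative g' V) (at t)"
proof -
  have "range (\<lambda>s. X + s *\<^sub>R V) \<subseteq> T"
    using T by (auto simp: subspace_add subspace_scale)
  then have "(g has_derivative g') (at (X + t *\<^sub>R V) within range (\<lambda>s. X + s *\<^sub>R V))"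
    using g has_derivative_subset by blast
  moreover have "((\<lambda>s. X + s *\<^sub>R V) has_derivative (\<lambda>s. s *\<^sub>R V)) (at t)"
    by (auto intro!: derivative_eq_intros)
  ultimately have "((\<lambda>s. g (X + s *\<^sub>R V)) has_derivative (\<lambda>s. g' (s *\<^sub>R V))) (at t)"
    using has_derivative_in_compose[of "\<lambda>s. X + s *\<^sub>R V" _ t UNIV g g'] by simp
  moreover have "g' (s *\<^sub>R V) = s *\<^sub>R g' V" for s
    using g has_derivative_linear linear_scale by blast
  ultimately show ?thesis by (simp add: has_vector_derivative_def)
qed

text \<open>Justifies the definite description in \<open>grad\<close>. Existence comes from
  symmetrizing a Riesz representative; uniqueness holds because the difference of two candidates is
  itself a symmetric direction and hence orthogonal to itself.\<close>

lemma grad_works: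
  fixes f :: "real^'n^'n \<Rightarrow> real"
  assumes "f differentiable_on sym_mats" "X \<in> sym_mats"
  shows "grad f X \<in> sym_mats \<and> (f has_derivative (\<lambda>V. grad f X \<bullet> V)) (at X within sym_mats)"
proof -
  let ?P = "\<lambda>G. G \<in> sym_mats \<and> (f has_derivative (\<lambda>V. G \<bullet> V)) (at X within sym_mats)"
  obtain L where L: "(f has_derivative L) (at X within sym_mats)"
    using assms by (auto simp: differentiable_on_def differentiable_def)
  \<comment> \<open>The adjoint of a functional, evaluated at 1, is its Riesz
    representative.\<close>
  define G0 where "G0 = adjoint L 1"
  have lin: "linear L" using L has_derivative_linear by blast
  have G0: "L V = G0 \<bullet> V" for V
    using adjoint_works[OF lin, of V 1] by (simp add: G0_def inner_commute)
  define G where "G = (1/2) *\<^sub>R (G0 + transpose G0)"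
  have Gsym: "G \<in> sym_mats"
    by (simp add: G_def sym_mats_def transpose_def vec_eq_iff)
  have GL: "G \<bullet> V = L V" if "V \<in> sym_mats" for V
  proof -
    have "transpose G0 \<bullet> V = G0 \<bullet> V"
      using inner_transpose_transpose[of G0 V] that by (simp add: sym_mats_def)
    then show ?thesis by (simp add: G_def G0 inner_add_left)
  qed
  have "(f has_derivative (\<lambda>V. G \<bullet> V)) (at X within sym_mats)"
    unfolding has_derivative_within
  proof
    show "bounded_linear ((\<bullet>) G)" by (rule bounded_linear_inner_right)
    have lim: "((\<lambda>y. (1 / norm (y - X)) *\<^sub>R (f y - (f X + L (y - X)))) \<longlongrightarrow> 0)
        (at X within sym_mats)"
      using L by (simp add: has_derivative_within)
    \<comment> \<open>Increments \<open>y - X\<close> inside \<open>sym_mats\<close> are symmetric,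
      where \<open>G\<close> and \<open>L\<close> agree, so the difference quotients
      coincide.\<close>
    have "\<forall>\<^sub>F y in at X within sym_mats.
        (1 / norm (y - X)) *\<^sub>R (f y - (f X + L (y - X))) =
        (1 / norm (y - X)) *\<^sub>R (f y - (f X + G \<bullet> (y - X)))"
      using assms(2) by (auto simp: eventually_at_filter GL subspace_diff[OF subspace_sym_mats])
    then show "((\<lambda>y. (1 / norm (y - X)) *\<^sub>R (f y - (f X + G \<bullet> (y - X)))) \<longlongrightarrow> 0)
        (at X within sym_mats)"
      using lim by (rule Lim_transform_eventually[rotated])
  qed
  with Gsym have ex: "?P G" by simp
  have uniq: "G1 = G2" if G12: "?P G1" "?P G2" for G1 G2
  proof -
    have "G1 \<bullet> V = G2 \<bullet> V" if V: "V \<in> sym_mats" for V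
    proof (rule vector_derivative_unique_at)
      show "((\<lambda>s. f (X + s *\<^sub>R V)) has_vector_derivative G1 \<bullet> V) (at 0)"
        by (rule has_vector_derivative_along_line[where T = sym_mats])
          (use G12 V assms(2) subspace_sym_mats in simp_all)
      show "((\<lambda>s. f (X + s *\<^sub>R V)) has_vector_derivative G2 \<bullet> V) (at 0)"
        by (rule has_vector_derivative_along_line[where T = sym_mats])
          (use G12 V assms(2) subspace_sym_mats in simp_all)
    qed
    moreover have "G1 - G2 \<in> sym_mats"
      using G12 subspace_diff[OF subspace_sym_mats] by blast
    ultimately have "(G1 - G2) \<bullet> (G1 - G2) = 0"
      unfolding inner_diff_left by simp
    then show ?thesis by simp
  qed
  show ?thesis
    unfolding grad_def by (rule theI[where P = ?P, OF ex]) (use uniq ex in blast)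
qed

lemma hess_along_line:
  fixes f :: "real^'n^'n \<Rightarrow> real"
  assumes "grad f differentiable_on sym_mats" "X \<in> sym_mats" "V \<in> sym_mats"
  shows "((\<lambda>s. grad f (X + s *\<^sub>R V)) has_vector_derivative hess f X V) (at 0)"
proof -
  have "(grad f has_derivative hess f X) (at X within sym_mats)"
    using assms by (simp add: differentiable_on_def frechet_derivative_works hess_def[abs_def])
  then show ?thesis
    using has_vector_derivative_along_line[of "grad f" "hess f X" X 0 V sym_mats]
      assms subspace_sym_mats by simp
qed

text \<open>The gradient is symmetric along the whole line, so transposing the curve changes
  nothing; uniqueness of its derivative gives the claim.\<close>

lemma hess_sym:
  fixes f :: "real^'n^'n \<Rightarrow> real"
  assumes "twice_cont_diff_sym f" "X \<in> sym_mats" "V \<in> sym_mats"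
  shows "hess f X V \<in> sym_mats"
proof -
  have d: "((\<lambda>s. grad f (X + s *\<^sub>R V)) has_vector_derivative hess f X V) (at 0)"
    using assms hess_along_line by (auto simp: twice_cont_diff_sym_def)
  have "X + s *\<^sub>R V \<in> sym_mats" for s
    using assms by (simp add: subspace_add subspace_scale subspace_sym_mats)
  then have "transpose (grad f (X + s *\<^sub>R V)) = grad f (X + s *\<^sub>R V)" for s
    using grad_works[of f "X + s *\<^sub>R V"] assms(1)
    by (auto simp: twice_cont_diff_sym_def sym_mats_def)
  then have "((\<lambda>s. grad f (X + s *\<^sub>R V)) has_vector_derivative transpose (hess f X V)) (at 0)"
    using bounded_linear.has_vector_derivative[OF
        linear_conv_bounded_linear[THEN iffD1, OF linear_transpose] d] by simp
  then show ?thesis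
    using d vector_derivative_unique_at by (auto simp: sym_mats_def)
qed

text \<open>On the line through \<open>X\<close> in direction \<open>V\<close>, concavity bounds the
  slope to the right of 0 by the slope at 0. The derivative of this slope at 0 is the quadratic form
  in question.\<close>

lemma concave_hess_nonpos:
  fixes f :: "real^'n^'n \<Rightarrow> real"
  assumes tw: "twice_cont_diff_sym f" and conc: "concave_on sym_mats f"
    and X: "X \<in> sym_mats" and V: "V \<in> sym_mats"
  shows "hess f X V \<bullet> V \<le> 0"
proof -
  have line: "X + s *\<^sub>R V \<in> sym_mats" for s
    using assms by (simp add: subspace_add subspace_scale subspace_sym_mats)
  define \<psi> where "\<psi> s = grad f (X + s *\<^sub>R V) \<bullet> V" for s
  have d1: "((\<lambda>s. f (X + s *\<^sub>R V)) has_real_derivative \<psi> s) (at s)" for s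
    unfolding \<psi>_def has_real_derivative_iff_has_vector_derivative
    by (rule has_vector_derivative_along_line[where T = sym_mats])
      (use grad_works[OF _ line] tw X V subspace_sym_mats in \<open>auto simp: twice_cont_diff_sym_def\<close>)
  have conv: "convex_on UNIV (\<lambda>s. - f (X + s *\<^sub>R V))"
  proof (rule convex_onI)
    fix t x y :: real
    assume t: "0 < t" "t < 1"
    have "(1 - t) *\<^sub>R (X + x *\<^sub>R V) + t *\<^sub>R (X + y *\<^sub>R V) = X + ((1 - t) *\<^sub>R x + t *\<^sub>R y) *\<^sub>R V"
      by (simp add: algebra_simps)
    then show "- f (X + ((1 - t) *\<^sub>R x + t *\<^sub>R y) *\<^sub>R V)
        \<le> (1 - t) * - f (X + x *\<^sub>R V) + t * - f (X + y *\<^sub>R V)"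
      using convex_onD[of sym_mats "\<lambda>x. - f x" t "X + x *\<^sub>R V" "X + y *\<^sub>R V"] conc t line
      by (simp add: concave_on_def)
  qed simp
  have tangent: "- f (X + y *\<^sub>R V) + f (X + x *\<^sub>R V) \<ge> - \<psi> x * (y - x)" for x y
    using convex_on_imp_above_tangent[OF conv, of x y "- \<psi> x"] DERIV_minus[OF d1, of x] by simp
  \<comment> \<open>Adding the tangent inequalities based at \<open>0\<close> and at
    \<open>h\<close> cancels the function values.\<close>
  have anti: "\<psi> h \<le> \<psi> 0" if "h > 0" for h
  proof -
    have "\<psi> h * h \<le> \<psi> 0 * h" using tangent[of 0 h] tangent[of h 0] by simp
    then show ?thesis using that by simp
  qed
  have d2: "(\<psi> has_real_derivative hess f X V \<bullet> V) (at 0)"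
    unfolding \<psi>_def[abs_def] has_real_derivative_iff_has_vector_derivative
    by (rule bounded_linear.has_vector_derivative[OF bounded_linear_inner_left])
      (use hess_along_line tw X V in \<open>auto simp: twice_cont_diff_sym_def\<close>)
  show ?thesis
  proof (rule ccontr)
    assume "\<not> ?thesis"
    then obtain e where "e > 0" "\<forall>h>0. h < e \<longrightarrow> \<psi> 0 < \<psi> (0 + h)"
      \<comment> \<open>A positive derivative would push the slope above its value at 0 immediately
        to the right, for instance at \<open>e/2\<close>.\<close>
      using DERIV_pos_inc_right[OF d2] by auto
    then show False using anti[of "e/2"] by (auto dest!: spec[of _ "e/2"])
  qed
qed

subsection \<open>The spectral theorem and negative eigenvalues\<close>

lemma inner_sym_mats:
  assumes "M \<in> sym_mats"
  shows "x \<bullet> (M *v y) = (M *v x) \<bullet> y"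
proof -
  have "transpose M = M" using assms by (simp add: sym_mats_def)
  then have "x v* M = M *v x"
    using vector_transpose_matrix[of x M] by (simp only:)
  then show ?thesis using dot_lmul_matrix[of x M y] by simp
qed

text \<open>The quadratic form attains its maximum on the compact unit sphere of \<open>W\<close>,
  and a maximizer is an eigenvector whose eigenvalue is the maximum. Invariance of \<open>W\<close>
  keeps the residual \<open>z\<close> inside the set over which the maximum is taken.\<close>

lemma symmetric_eigenvector_exists:
  fixes M :: "real^'n^'n"
  assumes M: "M \<in> sym_mats" and W: "subspace W" and inv: "\<And>w. w \<in> W \<Longrightarrow> M *v w \<in> W"
    and ne: "W \<noteq> {0}"
  obtains u c where "u \<in> W" "norm u = 1" "M *v u = c *\<^sub>R u"
proof -
  note sa = inner_sym_mats[OF M]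
  obtain w where w: "w \<in> W" "w \<noteq> 0" using ne W subspace_0 by blast
  have "compact (sphere 0 1 \<inter> W)"
    by (intro compact_Int_closed compact_sphere closed_subspace W)
  moreover have "w /\<^sub>R norm w \<in> sphere 0 1 \<inter> W"
    using w W by (simp add: subspace_scale)
  moreover have "continuous_on (sphere 0 1 \<inter> W) (\<lambda>v. v \<bullet> (M *v v))"
    by (intro continuous_intros)
  ultimately obtain u where u: "u \<in> sphere 0 1 \<inter> W"
    and max: "\<And>v. v \<in> sphere 0 1 \<inter> W \<Longrightarrow> v \<bullet> (M *v v) \<le> u \<bullet> (M *v u)"
    using continuous_attains_sup[of "sphere 0 1 \<inter> W" "\<lambda>v. v \<bullet> (M *v v)"] by blast
  define c where "c = u \<bullet> (M *v u)"
  have uu: "u \<bullet> u = 1" using u by (simp add: norm_eq_1)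
  have le: "v \<bullet> (M *v v) \<le> c * (v \<bullet> v)" if "v \<in> W" for v
  proof (cases "v = 0")
    case False
    have "(v /\<^sub>R norm v) \<bullet> (M *v (v /\<^sub>R norm v)) \<le> c"
      unfolding c_def using that False W by (intro max) (simp add: subspace_scale)
    then show ?thesis using False
      by (simp add: matrix_vector_mult_scaleR power2_norm_eq_inner[symmetric] field_simps power2_eq_square)
  qed simp
  define z where "z = M *v u - c *\<^sub>R u"
  have zW: "z \<in> W" using u inv W by (auto simp: z_def subspace_diff subspace_scale)
  define b where "b = z \<bullet> (M *v z) - c * (z \<bullet> z)"
  have b: "b \<le> 0" using le[OF zW] by (simp add: b_def)
  have zz: "z \<bullet> (M *v u) - c * (z \<bullet> u) = z \<bullet> z"
    by (simp add: z_def inner_diff_right)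
  \<comment> \<open>Moving the maximizer \<open>u\<close> in the direction of its residual \<open>z\<close> cannot increase the Rayleigh quotient.\<close>
  have quad: "2 * t * (z \<bullet> z) + t\<^sup>2 * b \<le> 0" for t
  proof -
    have "u + t *\<^sub>R z \<in> W" using u zW W by (simp add: subspace_add subspace_scale)
    from le[OF this] have "c + 2 * t * (z \<bullet> (M *v u)) + t\<^sup>2 * (z \<bullet> (M *v z))
      \<le> c * (1 + 2 * t * (z \<bullet> u) + t\<^sup>2 * (z \<bullet> z))"
      using sa[of u z] uu
      by (simp add: matrix_vector_right_distrib matrix_vector_mult_scaleR inner_add_left
          inner_add_right c_def[symmetric] power2_eq_square inner_commute algebra_simps)
    then have "2 * t * (z \<bullet> (M *v u) - c * (z \<bullet> u)) + t\<^sup>2 * b \<le> 0"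
      by (simp add: b_def algebra_simps)
    then show ?thesis by (simp add: zz)
  qed
  \<comment> \<open>A quadratic in \<open>t\<close> without constant term that is never positive has
    no linear term. For \<open>b < 0\<close> the test value of \<open>t\<close> is the vertex of the
    parabola.\<close>
  have "z \<bullet> z = 0"
  proof (cases "b = 0")
    case True
    then show ?thesis using quad[of 1] inner_ge_zero[of z] by simp
  next
    case False
    have "- ((z \<bullet> z)\<^sup>2 / b) \<le> 0"
      using quad[of "- (z \<bullet> z) / b"] False by (simp add: power2_eq_square field_simps)
    then show ?thesis using b False by (simp add: divide_le_0_iff zero_le_divide_iff)
  qed
  then have "M *v u = c *\<^sub>R u" by (simp add: z_def)
  then show ?thesis using that u by auto
qed

text \<open>Take an orthonormal set of eigenvectors of maximal cardinality. Its orthogonal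
  complement \<open>W\<close> is invariant under \<open>M\<close>, so a nonzero \<open>W\<close>
  would supply one more eigenvector.\<close>

lemma symmetric_orthonormal_eigenbasis:
  fixes M :: "real^'n^'n"
  assumes M: "M \<in> sym_mats"
  obtains B where "pairwise orthogonal B" "\<And>x. x \<in> B \<Longrightarrow> norm x = 1"
    "\<And>x. x \<in> B \<Longrightarrow> \<exists>c. M *v x = c *\<^sub>R x" "card B = CARD('n)"
proof -
  note sa = inner_sym_mats[OF M]
  define P where "P B \<longleftrightarrow> pairwise orthogonal B \<and> (\<forall>x\<in>B. norm x = 1) \<and>
    (\<forall>x\<in>B. \<exists>c. M *v x = c *\<^sub>R x)" for B
  have fin: "finite B \<and> card B \<le> CARD('n)" if "P B" for B
  proof -
    have "independent B" using that pairwise_orthogonal_independent[of B] by (force simp: P_def)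
    then show ?thesis using independent_bound[of B] by simp
  qed
  have "P {}" by (simp add: P_def)
  then obtain B where B: "P B" and max: "\<And>B'. P B' \<Longrightarrow> card B' \<le> card B"
    using ex_has_greatest_nat[of P "{}" card "Suc CARD('n)"] fin by (auto simp: less_Suc_eq_le)
  define W where "W = {w. \<forall>x\<in>B. x \<bullet> w = 0}"
  have subW: "subspace W" by (auto simp: W_def subspace_def inner_add_right)
  have inv: "M *v w \<in> W" if "w \<in> W" for w
  proof -
    have "x \<bullet> (M *v w) = 0" if "x \<in> B" for x
    proof -
      obtain c where "M *v x = c *\<^sub>R x" using B \<open>x \<in> B\<close> by (auto simp: P_def)
      then show ?thesis using \<open>w \<in> W\<close> \<open>x \<in> B\<close> by (simp add: sa W_def)
    qed
    then show ?thesis by (simp add: W_def)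
  qed
  have "W = {0}"
  proof (rule ccontr)
    assume "W \<noteq> {0}"
    then obtain u c where u: "u \<in> W" "norm u = 1" "M *v u = c *\<^sub>R u"
      using symmetric_eigenvector_exists[OF M subW inv] by blast
    then have "P (insert u B)"
      using B by (auto simp: P_def W_def pairwise_insert orthogonal_def inner_commute)
    moreover have "u \<notin> B" using u by (auto simp: W_def)
    ultimately show False using max[of "insert u B"] fin[OF B] by simp
  qed
  have "span B = UNIV"
  proof (rule ccontr)
    assume "span B \<noteq> UNIV"
    then obtain x where x: "x \<noteq> 0" "\<And>y. y \<in> span B \<Longrightarrow> orthogonal x y"
      using orthogonal_to_subspace_exists_gen[of B UNIV] by auto
    then have "x \<in> W"
      by (auto simp: W_def orthogonal_def inner_commute span_base)
    then show False using x(1) \<open>W = {0}\<close> by simp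
  qed
  moreover have "independent B"
    using B pairwise_orthogonal_independent[of B] by (force simp: P_def)
  ultimately have "card B = CARD('n)"
    by (metis dim_span_eq_card_independent dim_UNIV DIM_cart DIM_real mult.right_neutral)
  then show ?thesis using that B by (auto simp: P_def)
qed

text \<open>The entry type is kept general so that both real matrices and matrices of polynomials
  are covered.\<close>

definition diag_mat :: "('n \<Rightarrow> 'a::zero) \<Rightarrow> 'a^'n^'n" where
  "diag_mat c = (\<chi> i j. if i = j then c i else 0)"

theorem real_spectral_theorem:
  fixes M :: "real^'n^'n"
  assumes M: "M \<in> sym_mats"
  obtains Q c where "orthogonal_matrix Q" "M = Q ** diag_mat c ** transpose Q"
proof -
  obtain B where B: "pairwise orthogonal B" "\<And>x. x \<in> B \<Longrightarrow> norm x = 1"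
    "\<And>x. x \<in> B \<Longrightarrow> \<exists>c. M *v x = c *\<^sub>R x" "card B = CARD('n)"
    using symmetric_orthonormal_eigenbasis[OF M] by blast
  have "finite B" using B(4) by (metis card.infinite zero_less_card_finite less_irrefl)
  then obtain q where q: "bij_betw q (UNIV :: 'n set) B"
    using B(4) finite_same_card_bij[of "UNIV :: 'n set" B] by auto
  then have qB: "q i \<in> B" for i by (auto simp: bij_betw_def)
  obtain c where c: "M *v q i = c i *\<^sub>R q i" for i
    using B(3)[OF qB] by metis
  define Q where "Q = (\<chi> r i. q i $ r)"
  have col: "column i Q = q i" for i by (simp add: Q_def column_def vec_eq_iff)
  have orth: "orthogonal_matrix Q"
    unfolding orthogonal_matrix_orthonormal_columns col
  proof (intro conjI allI impI)
    show "norm (q i) = 1" for i using B(2) qB by blast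
    show "orthogonal (q i) (q j)" if "i \<noteq> j" for i j
      using B(1) qB q that by (metis UNIV_I bij_betw_def inj_on_def pairwiseD)
  qed
  have "M ** Q = Q ** diag_mat c"
  proof -
    have "(M ** Q) $ r $ i = (M *v q i) $ r" for r i
      by (simp add: matrix_matrix_mult_def matrix_vector_mult_def Q_def)
    then show ?thesis
      by (simp add: vec_eq_iff c) (simp add: matrix_matrix_mult_def diag_mat_def Q_def if_distrib cong: if_cong)
  qed
  moreover have "M = (M ** Q) ** transpose Q"
    using orth by (simp add: orthogonal_matrix_def flip: matrix_mul_assoc)
  ultimately show ?thesis using that orth by metis
qed

section \<open>Algebraic multiplicities read off from a diagonalization\<close>

lemma order_prod_linear:
  fixes c :: "'i \<Rightarrow> 'a::field"
  assumes "finite A"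
  shows "order x (\<Prod>i\<in>A. [:- c i, 1:]) = card {i\<in>A. c i = x}"
  using assms
proof (induction A rule: finite_induct)
  case (insert i A)
  have "(\<Prod>i\<in>A. [:- c i, 1:]) \<noteq> 0"
    using insert(1) by (subst prod_zero_iff) auto
  then have "[:- c i, 1:] * (\<Prod>i\<in>A. [:- c i, 1:]) \<noteq> 0"
    by (simp only: mult_eq_0_iff) simp
  from order_mult[OF this, of x]
  have "order x (\<Prod>i\<in>insert i A. [:- c i, 1:])
      = order x [:- c i, 1:] + card {i\<in>A. c i = x}"
    by (simp only: prod.insert[OF insert(1,2)] insert.IH)
  moreover have "order x [:- c i, 1:] = (if c i = x then 1 else 0)"
    using order_power_n_n[of x 1] by (auto intro: order_0I)
  moreover have "{j \<in> insert i A. c j = x} = (if c i = x then {i} else {}) \<union> {j\<in>A. c j = x}"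
    by auto
  ultimately show ?case using insert by auto
qed simp

text \<open>The embedding by constant polynomials is multiplicative, so a real diagonalization can
  be transported into the polynomial matrices that define \<open>charpoly\<close>.\<close>

definition const_poly_mat :: "real^'q^'r \<Rightarrow> real poly^'q^'r" where
  "const_poly_mat A = (\<chi> i j. [:A$i$j:])"

lemma const_poly_sum: "finite I \<Longrightarrow> [:sum g I:] = (\<Sum>i\<in>I. [:g i:])"
proof (induction I rule: finite_induct)
  case (insert i I)
  show ?case
    by (simp only: sum.insert[OF insert.hyps] insert.IH[symmetric] add_pCons add_0)
qed simp

lemma const_poly_mat_mult: "const_poly_mat (A ** B) = const_poly_mat A ** const_poly_mat B"
  by (simp add: const_poly_mat_def matrix_matrix_mult_def vec_eq_iff const_poly_sum mult.commute)

text \<open>Conjugation by \<open>Q\<close> turns the characteristic matrix into a diagonal one over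
  the polynomial ring, and the determinants of \<open>Q\<close> and its transpose multiply to
  1.\<close>

lemma charpoly_spectral:
  assumes orth: "orthogonal_matrix Q"
  shows "charpoly (Q ** diag_mat c ** transpose Q) = (\<Prod>i\<in>UNIV. [:- c i, 1:])"
proof -
  let ?C = "const_poly_mat"
  have one: "?C Q ** ?C (transpose Q) = mat 1"
    using orth by (simp add: orthogonal_matrix_def const_poly_mat_mult[symmetric])
      (simp add: const_poly_mat_def mat_def vec_eq_iff)
  \<comment> \<open>Scalar matrices are central, so \<open>mat [:0, 1:]\<close> is unchanged by
    conjugation with \<open>Q\<close>.\<close>
  have scal: "mat x ** A = A ** mat x" for x :: "real poly" and A :: "real poly^'a^'a"
    by (simp add: mat_def matrix_matrix_mult_def vec_eq_iff if_distrib if_distribR mult.commute cong: if_cong)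
  have "mat [:0, 1:] - ?C (Q ** diag_mat c ** transpose Q)
      = ?C Q ** diag_mat (\<lambda>i. [:- c i, 1:]) ** ?C (transpose Q)"
  proof -
    have "diag_mat (\<lambda>i. [:- c i, 1:]) = mat [:0, 1:] - ?C (diag_mat c)"
      by (simp add: diag_mat_def mat_def const_poly_mat_def vec_eq_iff)
    moreover have "?C Q ** mat [:0, 1:] ** ?C (transpose Q) = mat [:0, 1:]"
      by (metis scal matrix_mul_assoc one matrix_mul_rid)
    moreover have "(A - B) ** D = A ** D - B ** D" "D ** (A - B) = D ** A - D ** B" 
      for A B D :: "real poly^'a^'a"
      by (simp_all add: matrix_matrix_mult_def vec_eq_iff algebra_simps sum_subtractf)
    ultimately show ?thesis by (simp add: const_poly_mat_mult)
  qed
  moreover have "(\<chi> r s. (if r = s then [:0, 1:] else 0) - [:M$r$s:]) = mat [:0, 1:] - ?C M"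
    for M :: "real^'a^'a"
    by (simp add: mat_def const_poly_mat_def vec_eq_iff)
  ultimately have "charpoly (Q ** diag_mat c ** transpose Q)
    = det (?C Q) * det (diag_mat (\<lambda>i. [:- c i, 1:])) * det (?C (transpose Q))"
    by (simp add: charpoly_def det_mul)
  also have "\<dots> = det (diag_mat (\<lambda>i. [:- c i, 1:]))"
    using arg_cong[OF one, of det] by (simp add: det_mul)
  also have "\<dots> = (\<Prod>i\<in>UNIV. [:- c i, 1:])"
    by (subst det_diagonal) (simp_all add: diag_mat_def)
  finally show ?thesis .
qed

text \<open>The multiplicity of a root is the size of its fibre under \<open>c\<close>; the fibres
  over negative values are disjoint and exhaust the indices with \<open>c i < 0\<close>.\<close>

lemma num_neg_eigenvalues_spectral:
  assumes orth: "orthogonal_matrix Q"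
  shows "num_neg_eigenvalues (Q ** diag_mat c ** transpose Q) = card {i. c i < 0}"
proof -
  have "num_neg_eigenvalues (Q ** diag_mat c ** transpose Q)
      = (\<Sum>x\<in>c ` {i. c i < 0}. card {i. c i = x})"
    unfolding num_neg_eigenvalues_def charpoly_spectral[OF orth] order_prod_linear[OF finite]
    by (intro sum.cong) (auto simp: poly_prod)
  also have "\<dots> = card (\<Union>x\<in>c ` {i. c i < 0}. {i. c i = x})"
    by (subst card_UN_disjoint) auto
  also have "(\<Union>x\<in>c ` {i. c i < 0}. {i. c i = x}) = {i. c i < 0}" by auto
  finally show ?thesis .
qed

subsection \<open>Dimension counts and faces\<close>

text \<open>Rank-nullity on a subspace: \<open>h\<close> is injective on the orthogonal complement
  of the kernel within \<open>U\<close>, so this complement has dimension at most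
  \<open>dim V\<close>.\<close>

lemma dim_le_dim_image_plus_kernel:
  fixes h :: "'a::euclidean_space \<Rightarrow> 'b::euclidean_space"
  assumes h: "linear h" and U: "subspace U" and V: "h ` U \<subseteq> V"
  shows "dim U \<le> dim V + dim {u \<in> U. h u = 0}"
proof -
  let ?K = "{u \<in> U. h u = 0}"
  let ?W = "{y \<in> U. \<forall>x \<in> ?K. orthogonal x y}"
  have K: "subspace ?K"
    using U h by (auto simp: subspace_def linear_add linear_scale linear_0)
  have W: "subspace ?W"
    using U by (auto simp: subspace_def orthogonal_def inner_add_right)
  have "inj_on h ?W"
  proof (rule inj_onI)
    fix x y assume x: "x \<in> ?W" and y: "y \<in> ?W" and eq: "h x = h y"
    have "x - y \<in> ?K"
      using x y eq U h by (simp add: subspace_diff linear_diff)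
    moreover have "x - y \<in> ?W"
      using x y W subspace_diff by blast
    ultimately have "orthogonal (x - y) (x - y)" by blast
    then show "x = y" by (simp add: orthogonal_self)
  qed
  then have "inj_on h (span ?W)" using W by (simp only: span_eq_iff[THEN iffD2])
  then have "dim ?W = dim (h ` ?W)" using dim_image_eq[OF h] by simp
  also have "\<dots> \<le> dim V" using V by (intro dim_subset) auto
  finally show ?thesis
    using dim_subspace_orthogonal_to_vectors[OF K U] by auto
qed

lemma dim_supported_matrices:
  "dim {M :: real^'c^'r. \<forall>i j. (i, j) \<notin> I \<longrightarrow> M$i$j = 0} = card I"
proof -
  let ?e = "\<lambda>(i, j). axis i (axis j 1) :: real^'c^'r"
  have inj: "inj ?e" by (auto simp: inj_def axis_eq_axis)
  have Basis: "Basis = range ?e" by (force simp: Basis_vec_def)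
  have "{M :: real^'c^'r. \<forall>i j. (i, j) \<notin> I \<longrightarrow> M$i$j = 0}
      = {M. \<forall>b\<in>Basis. b \<notin> ?e ` I \<longrightarrow> M \<bullet> b = 0}"
    unfolding Basis using inj by (auto simp: inner_axis inj_image_mem_iff)
  also have "dim \<dots> = card (?e ` I)"
    by (rule dim_substandard) (auto simp: Basis)
  also have "\<dots> = card I"
    using inj by (simp add: card_image inj_on_subset)
  finally show ?thesis .
qed

text \<open>The numbering supplies a linear order on the index type, and the counted pairs form the
  upper triangle. This triangle and its mirror image cover all pairs and meet exactly in the
  diagonal.\<close>

lemma ex_numbering_card_ordered_pairs:
  obtains num :: "'n::finite \<Rightarrow> nat" where "inj num"
    "2 * card {(r, s). num r \<le> num s} = CARD('n) * (CARD('n) + 1)"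
proof -
  obtain num :: "'n \<Rightarrow> nat" where inj: "inj num"
    using finite_imp_inj_to_nat_seg[OF finite] by blast
  let ?L = "{(r, s). num r \<le> num s}" and ?G = "{(r, s). num s \<le> num r}"
  have "card ?G = card ?L"
    by (rule bij_betw_same_card[of prod.swap]) (auto simp: bij_betw_def inj_on_def image_iff)
  moreover have "?L \<union> ?G = UNIV" by auto
  moreover have "?L \<inter> ?G = (\<lambda>r. (r, r)) ` UNIV"
    using inj by (auto simp: inj_eq)
  then have "card (?L \<inter> ?G) = CARD('n)"
    by (simp add: card_image inj_on_def)
  ultimately have "2 * card ?L = CARD('n \<times> 'n) + CARD('n)"
    using card_Un_Int[of ?L ?G] by simp
  then show ?thesis using that inj by (simp add: algebra_simps)
qed

text \<open>Upper triangular matrices embed linearly into the symmetric ones by adding the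
  transpose. A lower bound is what the domain side of rank-nullity calls for.\<close>

lemma dim_sym_mats_ge: "CARD('n) * (CARD('n) + 1) \<le> 2 * dim (sym_mats :: (real^'n^'n) set)"
proof -
  obtain num :: "'n \<Rightarrow> nat" where inj: "inj num"
    and num: "2 * card {(r, s). num r \<le> num s} = CARD('n) * (CARD('n) + 1)"
    by (rule ex_numbering_card_ordered_pairs)
  let ?T = "{M :: real^'n^'n. \<forall>i j. (i, j) \<notin> {(r, s). num r \<le> num s} \<longrightarrow> M$i$j = 0}"
  let ?h = "\<lambda>M :: real^'n^'n. M + transpose M"
  have lin: "linear ?h"
    by (rule linearI) (simp_all add: transpose_def vec_eq_iff algebra_simps)
  have T: "subspace ?T" by (auto simp: subspace_def)
  have "M = 0" if M: "M \<in> ?T" and z: "?h M = 0" for M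
  proof -
    have e: "M$i$j + M$j$i = 0" for i j
      using z by (simp add: transpose_def vec_eq_iff)
    have "M$i$j = 0" for i j
    proof (cases "num i" "num j" rule: linorder_cases)
      case less
      then have "M$j$i = 0" using M by auto
      then show ?thesis using e[of i j] by simp
    next
      case equal
      then show ?thesis using inj e[of i j] by (simp add: inj_eq)
    next
      case greater
      then show ?thesis using M by auto
    qed
    then show ?thesis by (simp add: vec_eq_iff)
  qed
  then have "{M \<in> ?T. ?h M = 0} \<subseteq> {0}" by blast
  then have "dim {M \<in> ?T. ?h M = 0} = 0" by (simp only: dim_eq_0)
  moreover have "?h ` ?T \<subseteq> sym_mats"
    by (auto simp: sym_mats_def transpose_def vec_eq_iff)
  ultimately have "dim ?T \<le> dim (sym_mats :: (real^'n^'n) set)"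
    using dim_le_dim_image_plus_kernel[OF lin T, of sym_mats] by linarith
  then show ?thesis
    using num unfolding dim_supported_matrices by simp
qed

text \<open>Such a matrix is determined by the upper triangles of its diagonal blocks. This space
  will hold the values of the tangency constraint, so the bound goes upwards.\<close>

lemma dim_sym_block_diagonal_le:
  "2 * dim {M :: real^('m::finite \<times> 'd::finite)^('m \<times> 'd).
      M \<in> sym_mats \<and> (\<forall>r s. fst r \<noteq> fst s \<longrightarrow> M$r$s = 0)}
    \<le> CARD('m) * (CARD('d) * (CARD('d) + 1))"
  (is "2 * dim ?V \<le> _")
proof -
  obtain num :: "'d \<Rightarrow> nat" where inj: "inj num"
    and num: "2 * card {(r, s). num r \<le> num s} = CARD('d) * (CARD('d) + 1)"
    by (rule ex_numbering_card_ordered_pairs)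
  define I :: "(('m \<times> 'd) \<times> ('m \<times> 'd)) set"
    where "I = {(r, s). fst r = fst s \<and> num (snd r) \<le> num (snd s)}"
  let ?T = "{M :: real^('m \<times> 'd)^('m \<times> 'd). \<forall>i j. (i, j) \<notin> I \<longrightarrow> M$i$j = 0}"
  define h :: "real^('m \<times> 'd)^('m \<times> 'd) \<Rightarrow> real^('m \<times> 'd)^('m \<times> 'd)"
    where "h M = (\<chi> r s. if (r, s) \<in> I then M$r$s else 0)" for M
  have lin: "linear h"
    by (rule linearI) (simp_all add: h_def vec_eq_iff)
  have V: "subspace ?V"
    by (auto simp: subspace_def sym_mats_def transpose_def vec_eq_iff)
  have "M = 0" if M: "M \<in> ?V" and z: "h M = 0" for M
  proof -
    have sym: "M$r$s = M$s$r" for r s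
    proof -
      have "transpose M $ s $ r = M $ s $ r" using M by (simp add: sym_mats_def)
      then show ?thesis by (simp add: transpose_def)
    qed
    have e: "M$r$s = 0" if "(r, s) \<in> I" for r s
    proof -
      have "h M $ r $ s = 0" using z by simp
      then show ?thesis using that by (simp add: h_def)
    qed
    have "M$r$s = 0" for r s
    proof (cases "fst r = fst s")
      case True
      then have "(r, s) \<in> I \<or> (s, r) \<in> I" by (auto simp: I_def)
      then show ?thesis using e sym by metis
    next
      case False
      then show ?thesis using M by blast
    qed
    then show ?thesis by (simp add: vec_eq_iff)
  qed
  then have "{M \<in> ?V. h M = 0} \<subseteq> {0}" by blast
  then have "dim {M \<in> ?V. h M = 0} = 0" by (simp only: dim_eq_0)
  moreover have "h ` ?V \<subseteq> ?T" by (auto simp: h_def)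
  ultimately have "dim ?V \<le> dim ?T"
    using dim_le_dim_image_plus_kernel[OF lin V, of ?T] by linarith
  moreover have "card I = CARD('m) * card {(r, s). num r \<le> num s}"
  proof -
    have "I = (\<lambda>(i, a, b). ((i, a), (i, b))) ` (UNIV \<times> {(r, s). num r \<le> num s})"
      by (force simp: I_def)
    moreover have "inj (\<lambda>(i :: 'm, a :: 'd, b :: 'd). ((i, a), (i, b)))"
      by (auto simp: inj_def)
    ultimately show ?thesis
      by (simp add: card_image inj_on_subset card_cartesian_product)
  qed
  ultimately have "2 * dim ?V \<le> CARD('m) * (2 * card {(r, s). num r \<le> num s})"
    unfolding dim_supported_matrices by simp
  then show ?thesis unfolding num .
qed

section \<open>Faces of a convex set and their dimension\<close>

text \<open>Choose a face through \<open>x\<close> of least affine dimension. Were \<open>x\<close>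
  on its relative boundary, a supporting hyperplane at \<open>x\<close> would cut out a face of
  smaller dimension still containing \<open>x\<close>.\<close>

lemma ex_face_of_rel_interior:
  fixes C :: "'a::euclidean_space set"
  assumes C: "convex C" and x: "x \<in> C"
  obtains F where "F face_of C" "x \<in> rel_interior F"
proof -
  let ?P = "\<lambda>F. F face_of C \<and> x \<in> F"
  have "?P C" using C x by (simp add: face_of_refl)
  then obtain F where F: "?P F" and min: "\<And>G. ?P G \<Longrightarrow> nat (aff_dim F) \<le> nat (aff_dim G)"
    using ex_has_least_nat[of ?P C "\<lambda>F. nat (aff_dim F)"] by blast
  have "x \<in> rel_interior F"
  proof (rule ccontr)
    assume nx: "x \<notin> rel_interior F"
    have conv: "convex F" using F face_of_imp_convex by blast
    obtain a where "a \<noteq> 0" and a: "\<And>y. y \<in> F \<Longrightarrow> a \<bullet> x \<le> a \<bullet> y"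
      "\<And>y. y \<in> rel_interior F \<Longrightarrow> a \<bullet> x < a \<bullet> y"
      by (rule supporting_hyperplane_rel_boundary[OF conv conjunct2[OF F] nx]) blast
    let ?G = "F \<inter> {y. a \<bullet> y = a \<bullet> x}"
    have G: "?G face_of F"
      by (rule face_of_Int_supporting_hyperplane_ge[OF conv a(1)])
    have "rel_interior F \<noteq> {}" using F conv rel_interior_eq_empty by auto
    then obtain y where y: "y \<in> rel_interior F" by blast
    have "y \<notin> ?G" using a(2)[OF y] by simp
    moreover have "y \<in> F" using y rel_interior_subset by blast
    ultimately have "?G \<noteq> F" by metis
    then have "aff_dim ?G < aff_dim F" by (rule face_of_aff_dim_lt[OF conv G])
    moreover have "?P ?G" using F G face_of_trans by blast
    \<comment> \<open>Nonemptiness rules out affine dimension -1, so the truncation by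
      \<open>nat\<close> does not hide the strict decrease.\<close>
    moreover have "?G \<noteq> {}" using F by blast
    then have "aff_dim ?G \<ge> 0" using aff_dim_negative_iff[of ?G] by linarith
    ultimately show False using min[of ?G] by linarith
  qed
  then show ?thesis using that F by blast
qed

text \<open>Two faces whose relative interiors share a point are equal, which makes the description
  in \<open>face_at\<close> definite.\<close>

lemma face_at_works:
  fixes C :: "'a::euclidean_space set"
  assumes "convex C" "x \<in> C"
  shows "face_at C x face_of C \<and> x \<in> rel_interior (face_at C x)"
proof -
  obtain F where F: "F face_of C \<and> x \<in> rel_interior F"
    using ex_face_of_rel_interior[OF assms] by blast
  show ?thesis
    unfolding face_at_def
    by (rule theI[where P = "\<lambda>F. F face_of C \<and> x \<in> rel_interior F", OF F])
      (use F face_of_eq in blast)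
qed

text \<open>If \<open>C\<close> allows a move from \<open>x\<close> both ways along
  \<open>v\<close>, then \<open>x\<close> is inside a segment of \<open>C\<close>, whose endpoints
  the face must contain. So all of \<open>K\<close> lies in the direction space of
  \<open>F\<close>.\<close>

lemma aff_dim_face_ge:
  fixes F :: "'a::euclidean_space set"
  assumes F: "F face_of C" and x: "x \<in> F"
    and dirs: "\<And>v. v \<in> K \<Longrightarrow> \<exists>e>0. x + e *\<^sub>R v \<in> C \<and> x - e *\<^sub>R v \<in> C"
  shows "int (dim K) \<le> aff_dim F"
proof -
  have "v \<in> span ((+) (- x) ` F)" if v: "v \<in> K" for v
  proof (cases "v = 0")
    case False
    obtain e where e: "e > 0" "x + e *\<^sub>R v \<in> C" "x - e *\<^sub>R v \<in> C" using dirs v by blast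
    have "x = midpoint (x - e *\<^sub>R v) (x + e *\<^sub>R v)"
      by (simp add: midpoint_def scaleR_2[symmetric])
    moreover have "x - e *\<^sub>R v \<noteq> x + e *\<^sub>R v"
    proof
      assume "x - e *\<^sub>R v = x + e *\<^sub>R v"
      then have "(x + e *\<^sub>R v) - (x - e *\<^sub>R v) = 0" by (simp only: diff_self)
      moreover have "(x + e *\<^sub>R v) - (x - e *\<^sub>R v) = (e + e) *\<^sub>R v"
        by (simp only: scaleR_add_left) simp
      ultimately have "(e + e) *\<^sub>R v = 0" by (simp only:)
      then show False using e False by simp
    qed
    ultimately have "x \<in> open_segment (x - e *\<^sub>R v) (x + e *\<^sub>R v)"
      by (metis midpoint_in_open_segment)
    then have "x + e *\<^sub>R v \<in> F" using F x e unfolding face_of_def by blast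
    then have "e *\<^sub>R v \<in> span ((+) (- x) ` F)"
      by (intro span_base) (force simp: image_iff)
    then have "(1 / e) *\<^sub>R (e *\<^sub>R v) \<in> span ((+) (- x) ` F)" by (rule span_scale)
    then show ?thesis using e by simp
  qed (simp add: span_zero)
  then have "dim K \<le> dim (span ((+) (- x) ` F))" by (intro dim_subset) auto
  then show ?thesis using aff_dim_eq_dim[OF hull_inc[OF x]] by simp
qed

subsection \<open>Feasible matrices and the tangent space\<close>

lemma transpose_scaleR: "transpose (c *\<^sub>R A) = c *\<^sub>R transpose (A :: real^'q^'r)"
  by (simp add: transpose_def vec_eq_iff)

lemma matrix_mult_scaleR_left: "(c *\<^sub>R A) ** B = c *\<^sub>R ((A :: real^'q^'r) ** (B :: real^'s^'q))"
  using linear_scale[OF linear_matrix_mult_right] .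

lemma matrix_mult_scaleR_right: "A ** (c *\<^sub>R B) = c *\<^sub>R ((A :: real^'q^'r) ** (B :: real^'s^'q))"
  using linear_scale[OF linear_matrix_mult_left] .

lemma inner_transpose_self_mult:
  fixes Y :: "real^'p^'n"
  shows "v \<bullet> ((Y ** A ** transpose Y) *v v) = (transpose Y *v v) \<bullet> (A *v (transpose Y *v v))"
proof -
  have "v \<bullet> ((Y ** A ** transpose Y) *v v) = v \<bullet> (Y *v (A *v (transpose Y *v v)))"
    by (simp only: matrix_vector_mul_assoc matrix_mul_assoc)
  also have "\<dots> = (v v* Y) \<bullet> (A *v (transpose Y *v v))"
    by (rule dot_lmul_matrix[symmetric])
  also have "v v* Y = transpose Y *v v"
    using vector_transpose_matrix[of v "transpose Y"] by simp
  finally show ?thesis .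
qed

lemma symblockdiag_nth:
  "symblockdiag M $ r $ s =
    (if fst r = fst s then (M $ r $ s + M $ (fst r, snd s) $ (fst r, snd r)) / 2 else 0)"
  by (cases r; cases s) (auto simp: symblockdiag_def block_def transpose_def)

lemma linear_symblockdiag: "linear symblockdiag"
  by (rule linearI) (simp_all add: symblockdiag_nth vec_eq_iff field_simps)

lemma symblockdiag_sym: "symblockdiag M \<in> sym_mats"
  by (auto simp: symblockdiag_nth sym_mats_def transpose_def vec_eq_iff)

lemma block_diagonal_symblockdiag: "block_diagonal (symblockdiag M)"
  by (simp add: block_diagonal_def block_def symblockdiag_nth vec_eq_iff)

text \<open>For a symmetric matrix the averaging in \<open>symblockdiag\<close> leaves the diagonal
  blocks as they are.\<close>

lemma symblockdiag_eq_0_imp_block: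
  assumes "symblockdiag M = 0" "M \<in> sym_mats"
  shows "block M i i = 0"
proof -
  have "M $ (i, a) $ (i, b) = 0" for a b
  proof -
    have "symblockdiag M $ (i, a) $ (i, b) = 0" using assms(1) by simp
    moreover have "transpose M $ (i, b) $ (i, a) = M $ (i, b) $ (i, a)"
      using assms(2) by (simp add: sym_mats_def)
    ultimately show ?thesis by (simp add: symblockdiag_nth transpose_def)
  qed
  then show ?thesis by (simp add: block_def vec_eq_iff)
qed

lemma gram_sym: "(Y :: real^'p^'n) ** transpose Y \<in> sym_mats"
  by (simp add: sym_mats_def matrix_transpose_mul)

lemma congruence_sym:
  fixes Y :: "real^'p^'n"
  assumes "A \<in> sym_mats"
  shows "Y ** A ** transpose Y \<in> sym_mats"
  using assms by (simp add: sym_mats_def matrix_transpose_mul matrix_mul_assoc)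

lemma block_gram:
  assumes "Y \<in> stiefel"
  shows "block (Y ** transpose Y) i i = mat 1"
proof -
  have "block (Y ** transpose Y) i i = slice Y i ** transpose (slice Y i)"
    by (simp add: block_def slice_def matrix_matrix_mult_def transpose_def vec_eq_iff)
  then show ?thesis using assms by (simp add: stiefel_def)
qed

lemma block_add: "block (M + N) i j = block M i j + block N i j"
  by (simp add: block_def vec_eq_iff)

lemma block_scaleR: "block (c *\<^sub>R M) i j = c *\<^sub>R block M i j"
  by (simp add: block_def vec_eq_iff)

lemma gram_feasible: "Y \<in> stiefel \<Longrightarrow> Y ** transpose Y \<in> feasible"
  using inner_transpose_self_mult[of _ Y "mat 1"]
  by (auto simp: feasible_def psd_def gram_sym block_gram)

lemma convex_feasible: "convex feasible"
proof (rule convexI)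
  fix M N :: "real^('a \<times> 'b)^('a \<times> 'b)" and u v :: real
  assume M: "M \<in> feasible" and N: "N \<in> feasible" and uv: "0 \<le> u" "0 \<le> v" "u + v = 1"
  have "u *\<^sub>R M + v *\<^sub>R N \<in> sym_mats"
    using M N by (simp add: feasible_def psd_def subspace_add subspace_scale subspace_sym_mats)
  moreover have "x \<bullet> ((u *\<^sub>R M + v *\<^sub>R N) *v x) \<ge> 0" for x
  proof -
    have "x \<bullet> ((u *\<^sub>R M + v *\<^sub>R N) *v x) = u * (x \<bullet> (M *v x)) + v * (x \<bullet> (N *v x))"
      by (simp add: matrix_vector_mult_add_rdistrib scaleR_matrix_vector_assoc[symmetric]
          inner_add_right)
    then show ?thesis using M N uv by (simp add: feasible_def psd_def)
  qed
  moreover have "block (u *\<^sub>R M + v *\<^sub>R N) i i = mat 1" for i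
    using M N uv by (simp add: feasible_def block_add block_scaleR flip: scaleR_add_left)
  ultimately show "u *\<^sub>R M + v *\<^sub>R N \<in> feasible" by (simp add: feasible_def psd_def)
qed

text \<open>The perturbed matrix is the congruence by \<open>Y\<close> of the identity plus or minus
  \<open>e\<close> times \<open>A\<close>, which stays positive semidefinite for small
  \<open>e\<close>. The diagonal blocks do not move because those of the perturbation
  vanish.\<close>

lemma gram_perturbation_feasible:
  fixes Y :: "real^'p^('m::finite \<times> 'd::finite)"
  assumes Y: "Y \<in> stiefel" and A: "A \<in> sym_mats"
    and z: "symblockdiag (Y ** A ** transpose Y) = 0"
  shows "\<exists>e>0. Y ** transpose Y + e *\<^sub>R (Y ** A ** transpose Y) \<in> feasible \<and>
    Y ** transpose Y - e *\<^sub>R (Y ** A ** transpose Y) \<in> feasible"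
proof -
  let ?V = "Y ** A ** transpose Y"
  obtain B where B: "B > 0" "\<And>w. norm (A *v w) \<le> norm w * B"
    using bounded_linear.pos_bounded[OF matrix_vector_mul_bounded_linear[of A]] by blast
  \<comment> \<open>The scaling is tuned to the bound \<open>B\<close> on \<open>A\<close>; both
    signs \<open>1 / B\<close> and \<open>- 1 / B\<close> are covered at once.\<close>
  have "Y ** transpose Y + c *\<^sub>R ?V \<in> feasible" if c: "\<bar>c\<bar> * B = 1" for c
  proof -
    have "0 \<le> v \<bullet> ((Y ** transpose Y + c *\<^sub>R ?V) *v v)" for v
    proof -
      let ?w = "transpose Y *v v"
      have "\<bar>?w \<bullet> (A *v ?w)\<bar> \<le> norm ?w * (norm ?w * B)"
        using Cauchy_Schwarz_ineq2[of ?w "A *v ?w"] B(2)[of ?w]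
        by (meson order_trans mult_left_mono norm_ge_zero)
      then have "\<bar>c\<bar> * \<bar>?w \<bullet> (A *v ?w)\<bar> \<le> \<bar>c\<bar> * (norm ?w * (norm ?w * B))"
        by (rule mult_left_mono) simp
      also have "\<dots> = (\<bar>c\<bar> * B) * (norm ?w * norm ?w)" by (simp only: ac_simps)
      also have "\<dots> = ?w \<bullet> ?w"
        by (simp only: c) (simp add: dot_square_norm power2_eq_square)
      finally have "\<bar>c * (?w \<bullet> (A *v ?w))\<bar> \<le> ?w \<bullet> ?w" by (simp add: abs_mult)
      moreover have "v \<bullet> ((Y ** transpose Y + c *\<^sub>R ?V) *v v) = ?w \<bullet> ?w + c * (?w \<bullet> (A *v ?w))"
        using inner_transpose_self_mult[of v Y "mat 1"] inner_transpose_self_mult[of v Y A]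
        by (simp add: matrix_vector_mult_add_rdistrib scaleR_matrix_vector_assoc[symmetric]
            inner_add_right)
      ultimately show ?thesis by linarith
    qed
    moreover have "Y ** transpose Y + c *\<^sub>R ?V \<in> sym_mats"
      by (intro subspace_add subspace_scale subspace_sym_mats gram_sym congruence_sym A)
    ultimately show ?thesis
      using symblockdiag_eq_0_imp_block[OF z congruence_sym[OF A]]
      by (simp add: feasible_def psd_def block_add block_scaleR block_gram[OF Y])
  qed
  from this[of "1 / B"] this[of "- 1 / B"] show ?thesis
    using B(1) by (intro exI[of _ "1 / B"]) simp
qed

section \<open>The second-order condition under concavity\<close>

lemma S_mat_sym:
  assumes "twice_cont_diff_sym f" "X \<in> sym_mats"
  shows "S_mat f X \<in> sym_mats"
  using grad_works[of f X] assms symblockdiag_sym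
  by (auto simp: S_mat_def twice_cont_diff_sym_def intro!: subspace_diff[OF subspace_sym_mats])

text \<open>The Riemannian Hessian form at \<open>Y'\<close> equals \<open>?H \<bullet> ?X'\<close>
  plus twice the form of \<open>S_mat\<close>. The first term is nonpositive by concavity, so the
  second must be nonnegative.\<close>

lemma second_order_imp_nonneg_on_tangent:
  fixes f :: "real^('m::finite \<times> 'd::finite)^('m \<times> 'd) \<Rightarrow> real"
    and Y :: "real^'p::finite^('m \<times> 'd)"
  assumes tw: "twice_cont_diff_sym f" and conc: "concave_on sym_mats f"
    and so: "second_order_critical_point f Y" and T: "Y' \<in> tangent_space Y"
  shows "0 \<le> Y' \<bullet> (S_mat f (Y ** transpose Y) ** Y')"
proof -
  let ?X = "Y ** transpose Y" and ?X' = "Y' ** transpose Y + Y ** transpose Y'"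
  let ?H = "hess f ?X ?X'" and ?G = "grad f ?X"
  have X': "?X' \<in> sym_mats"
    by (simp add: sym_mats_def transpose_add matrix_transpose_mul add.commute)
  have H: "transpose ?H = ?H"
    using hess_sym[OF tw gram_sym X'] by (simp add: sym_mats_def)
  have "symblockdiag (grad_g f Y ** transpose Y) = 2 *\<^sub>R symblockdiag (?G ** ?X)"
    by (simp add: grad_g_def matrix_mult_scaleR_left linear_scale[OF linear_symblockdiag]
        matrix_mul_assoc)
  moreover have "S_mat f ?X ** Y' = ?G ** Y' - symblockdiag (?G ** ?X) ** Y'"
    unfolding S_mat_def by (rule linear_diff[OF linear_matrix_mult_right])
  ultimately have "hess_g f Y Y' - symblockdiag (grad_g f Y ** transpose Y) ** Y'
      = 2 *\<^sub>R (?H ** Y) + 2 *\<^sub>R (S_mat f ?X ** Y')"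
    by (simp add: hess_g_def matrix_mult_scaleR_left scaleR_add_right scaleR_diff_right)
  then have "0 \<le> 2 * (Y' \<bullet> (?H ** Y)) + 2 * (Y' \<bullet> (S_mat f ?X ** Y'))"
    using so T by (auto simp: second_order_critical_point_def inner_add_right)
  moreover have "Y' \<bullet> (?H ** Y) = (Y' ** transpose Y) \<bullet> ?H"
    by (rule inner_matrix_mult_left)
  \<comment> \<open>Since \<open>?H\<close> is symmetric, both summands of \<open>?X'\<close> pair
    with it equally, which accounts for the factor 2.\<close>
  moreover have "(Y ** transpose Y') \<bullet> ?H = (Y' ** transpose Y) \<bullet> ?H"
    using inner_transpose_transpose[of "Y' ** transpose Y" ?H] H
    by (simp add: matrix_transpose_mul)
  moreover have "?H \<bullet> ?X' \<le> 0" by (rule concave_hess_nonpos[OF tw conc gram_sym X'])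
  moreover have "?H \<bullet> ?X' = (Y' ** transpose Y) \<bullet> ?H + (Y ** transpose Y') \<bullet> ?H"
    by (simp only: inner_commute[of ?H ?X'] inner_add_left)
  ultimately show ?thesis by linarith
qed

subsection \<open>Negative eigenvalues at second-order critical points\<close>

text \<open>\<open>W\<close> holds coordinates in the eigenbasis \<open>Q\<close>. There the form is
  a sum of squares weighted by \<open>c i\<close>, and on the given support every weight is
  negative, so a nonnegative value forces all entries to vanish.\<close>

lemma negative_part_eq_0:
  fixes W :: "real^'p^'n"
  assumes orth: "orthogonal_matrix Q"
    and supp: "\<And>i j. \<not> c i < 0 \<Longrightarrow> W$i$j = 0"
    and nn: "0 \<le> (Q ** W) \<bullet> (Q ** diag_mat c ** transpose Q ** (Q ** W))"
  shows "W = 0"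
proof -
  have QQ: "transpose Q ** Q = mat 1" using orth by (simp add: orthogonal_matrix_def)
  have dW: "(diag_mat c ** W) $ i $ j = c i * W$i$j" for i j
    by (simp add: matrix_matrix_mult_def diag_mat_def if_distribR if_distrib cong: if_cong)
  have "Q ** diag_mat c ** transpose Q ** (Q ** W) = Q ** (diag_mat c ** ((transpose Q ** Q) ** W))"
    by (simp only: matrix_mul_assoc)
  then have "(Q ** W) \<bullet> (Q ** diag_mat c ** transpose Q ** (Q ** W))
      = (transpose Q ** (Q ** W)) \<bullet> (diag_mat c ** W)"
    by (simp only: QQ matrix_mul_lid inner_matrix_mult_right)
  also have "\<dots> = W \<bullet> (diag_mat c ** W)"
    by (simp add: matrix_mul_assoc QQ)
  also have "\<dots> = (\<Sum>i\<in>UNIV. \<Sum>j\<in>UNIV. c i * (W$i$j)\<^sup>2)"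
    by (simp add: inner_vec_def dW power2_eq_square algebra_simps)
  finally have le: "(\<Sum>i\<in>UNIV. \<Sum>j\<in>UNIV. - c i * (W$i$j)\<^sup>2) \<le> 0"
    using nn by (simp add: sum_negf)
  have ge: "0 \<le> - c i * (W$i$j)\<^sup>2" for i j
    using supp[of i j] by (cases "c i < 0") (auto simp: mult_nonpos_nonneg)
  have "(\<Sum>i\<in>UNIV. \<Sum>j\<in>UNIV. - c i * (W$i$j)\<^sup>2) = 0"
    by (intro antisym le sum_nonneg ge)
  moreover have "0 \<le> (\<Sum>j\<in>UNIV. - c i * (W$i$j)\<^sup>2)" for i
    by (intro sum_nonneg ge)
  ultimately have "\<forall>i\<in>UNIV. (\<Sum>j\<in>UNIV. - c i * (W$i$j)\<^sup>2) = 0"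
    using sum_nonneg_eq_0_iff[OF finite, of UNIV "\<lambda>i. \<Sum>j\<in>UNIV. - c i * (W$i$j)\<^sup>2"] by blast
  then have "\<forall>j\<in>UNIV. - c i * (W$i$j)\<^sup>2 = 0" for i
    using sum_nonneg_eq_0_iff[OF finite, of UNIV "\<lambda>j. - c i * (W$i$j)\<^sup>2"] ge by blast
  then have eq0: "- c i * (W$i$j)\<^sup>2 = 0" for i j by blast
  have "W$i$j = 0" for i j
    using eq0[of i j] supp[of i j] by (cases "c i < 0") auto
  then show ?thesis by (simp add: vec_eq_iff)
qed

text \<open>Full column rank gives \<open>Y\<close> a left inverse, so the congruence by
  \<open>Y\<close> is injective and preserves the dimension of the kernel. Its images are two-sided
  feasible directions at the Gram matrix.\<close>

lemma dim_constraint_kernel_le_aff_dim_face: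
  fixes Y :: "real^'p::finite^('m::finite \<times> 'd::finite)"
  assumes Y: "Y \<in> stiefel" and rank: "rank Y = CARD('p)"
    and F: "F face_of feasible" "Y ** transpose Y \<in> F"
  shows "int (dim {A \<in> sym_mats. symblockdiag (Y ** A ** transpose Y) = 0}) \<le> aff_dim F"
    (is "int (dim ?K) \<le> _")
proof -
  let ?c = "\<lambda>A. Y ** A ** transpose Y"
  have lin: "linear ?c"
    using linear_compose[OF linear_matrix_mult_left linear_matrix_mult_right] by (simp add: o_def)
  obtain B where B: "B ** Y = mat 1"
    using rank full_rank_injective matrix_left_invertible_injective by blast
  then have "transpose Y ** transpose B = mat 1"
    by (metis matrix_transpose_mul transpose_mat)
  then have "B ** ?c A ** transpose B = A" for A
    by (metis B matrix_mul_assoc matrix_mul_lid matrix_mul_rid)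
  then have "inj_on ?c (span ?K)" by (rule inj_on_inverseI)
  then have "dim ?K = dim (?c ` ?K)" using dim_image_eq[OF lin] by simp
  also have "int (dim (?c ` ?K)) \<le> aff_dim F"
    using gram_perturbation_feasible[OF Y] by (intro aff_dim_face_ge[OF F]) blast
  finally show ?thesis by simp
qed

text \<open>Rank-nullity for the tangency constraint evaluated at \<open>Q ** W + Y ** A\<close>, as
  a map of the pairs \<open>(W, A)\<close>. All terms are doubled so that the triangular numbers
  need no division.\<close>

lemma negative_eigenvalues_dim_bound:
  fixes Y :: "real^'p::finite^('m::finite \<times> 'd::finite)"
  assumes S: "S \<in> sym_mats" and SY: "S ** Y = 0"
    and nn: "\<And>Y'. Y' \<in> tangent_space Y \<Longrightarrow> 0 \<le> Y' \<bullet> (S ** Y')"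
  shows "2 * (num_neg_eigenvalues S * CARD('p)) + CARD('p) * (CARD('p) + 1)
    \<le> CARD('m) * (CARD('d) * (CARD('d) + 1)) +
      2 * dim {A \<in> sym_mats. symblockdiag (Y ** A ** transpose Y) = 0}" (is "_ \<le> _ + 2 * dim ?K")
proof -
  obtain Q c where orth: "orthogonal_matrix Q" and Sd: "S = Q ** diag_mat c ** transpose Q"
    using real_spectral_theorem[OF S] by blast
  define N where "N = {i. c i < 0}"
  \<comment> \<open>Matrices supported on the rows with negative \<open>c i\<close>; after
    multiplication by \<open>Q\<close> their columns span negative eigendirections of
    \<open>S\<close>.\<close>
  define U where "U = {W :: real^'p^('m \<times> 'd). \<forall>i j. (i, j) \<notin> N \<times> UNIV \<longrightarrow> W$i$j = 0}"
  let ?P = "\<lambda>x. Q ** fst x + Y ** snd x"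
  let ?L = "\<lambda>Y'. symblockdiag (Y' ** transpose Y + Y ** transpose Y')"
  have linP: "linear ?P"
    by (rule linearI) (simp_all add: matrix_add_ldistrib matrix_mult_scaleR_right scaleR_add_right)
  have "linear (\<lambda>Y'. Y' ** transpose Y + Y ** transpose Y')"
    using linear_compose[OF linear_transpose linear_matrix_mult_left, of Y]
    by (intro linear_compose_add linear_matrix_mult_right) (simp add: o_def)
  from linear_compose[OF linP linear_compose[OF this linear_symblockdiag]]
  have lin: "linear (\<lambda>x. ?L (?P x))" by (simp add: o_def)
  have subU: "subspace U" by (auto simp: U_def subspace_def)
  have dimU: "dim U = num_neg_eigenvalues S * CARD('p)"
    unfolding U_def dim_supported_matrices Sd num_neg_eigenvalues_spectral[OF orth] N_def
    by (simp add: card_cartesian_product)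
  have subK: "subspace ?K"
    by (auto simp: subspace_def sym_mats_def transpose_add transpose_scaleR matrix_add_ldistrib
        linear_add[OF linear_matrix_mult_right] linear_0[OF linear_matrix_mult_left]
        linear_0[OF linear_matrix_mult_right] linear_0[OF linear_transpose]
        matrix_mult_scaleR_left matrix_mult_scaleR_right
        linear_add[OF linear_symblockdiag] linear_scale[OF linear_symblockdiag]
        linear_0[OF linear_symblockdiag])
  have "x \<in> {0} \<times> ?K" if x: "x \<in> U \<times> sym_mats" "?L (?P x) = 0" for x
  proof -
    obtain W A where xWA: "x = (W, A)" by (cases x)
    have W: "W \<in> U" and A: "transpose A = A" using x by (auto simp: xWA sym_mats_def)
    let ?Y' = "Q ** W + Y ** A"
    have "?Y' \<in> tangent_space Y" using x(2) by (simp add: xWA tangent_space_def)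
    then have "0 \<le> ?Y' \<bullet> (S ** ?Y')" by (rule nn)
    moreover have SYA: "S ** (Y ** A) = 0"
      using linear_0[OF linear_matrix_mult_right] by (simp add: matrix_mul_assoc SY)
    \<comment> \<open>Symmetry moves \<open>S\<close> onto \<open>Y ** A\<close>, which it
      annihilates. So only the \<open>W\<close> part contributes to the form.\<close>
    moreover have "(Y ** A) \<bullet> (S ** (Q ** W)) = 0"
    proof -
      have "transpose S = S" using S by (simp add: sym_mats_def)
      then show ?thesis using SYA by (simp only: inner_matrix_mult_right) simp
    qed
    ultimately have "0 \<le> (Q ** W) \<bullet> (S ** (Q ** W))"
      by (simp add: matrix_add_ldistrib inner_add_left)
    then have "W = 0"
      using W by (intro negative_part_eq_0[OF orth, of c]) (auto simp: U_def N_def Sd)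
    then have "?Y' = Y ** A" using linear_0[OF linear_matrix_mult_left] by simp
    then have "?L (Y ** A) = 0" using x(2) by (simp add: xWA)
    moreover have "(Y ** A) ** transpose Y + Y ** transpose (Y ** A) = 2 *\<^sub>R (Y ** A ** transpose Y)"
      by (simp add: matrix_transpose_mul A matrix_mul_assoc scaleR_2)
    ultimately have "symblockdiag (Y ** A ** transpose Y) = 0"
      using linear_scale[OF linear_symblockdiag, of 2 "Y ** A ** transpose Y"] by simp
    then show ?thesis using \<open>W = 0\<close> A by (simp add: xWA sym_mats_def)
  qed
  then have "dim {x \<in> U \<times> sym_mats. ?L (?P x) = 0} \<le> dim ({0 :: real^'p^('m \<times> 'd)} \<times> ?K)"
    by (intro dim_subset) blast
  also have "\<dots> = dim ?K" by (simp only: dim_Times[OF subspace_single_0 subK]) simp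
  finally have ker: "dim {x \<in> U \<times> sym_mats. ?L (?P x) = 0} \<le> dim ?K" .
  let ?V = "{M :: real^('m \<times> 'd)^('m \<times> 'd).
      M \<in> sym_mats \<and> (\<forall>r s. fst r \<noteq> fst s \<longrightarrow> M$r$s = 0)}"
  \<comment> \<open>The constraint takes values in the symmetric block-diagonal matrices, whose
    dimension bounds its rank.\<close>
  have "(\<lambda>x. ?L (?P x)) ` (U \<times> sym_mats) \<subseteq> ?V"
    using symblockdiag_sym by (auto simp: symblockdiag_nth)
  from dim_le_dim_image_plus_kernel[OF lin subspace_Times[OF subU subspace_sym_mats] this]
  have "dim U + dim (sym_mats :: (real^'p^'p) set) \<le> dim ?V + dim ?K"
    using ker by (simp only: dim_Times[OF subU subspace_sym_mats])
  then show ?thesis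
    unfolding dimU
    using dim_sym_mats_ge[where 'n = 'p] dim_sym_block_diagonal_le[where 'm = 'm and 'd = 'd]
    by linarith
qed

text \<open>For \<open>v\<close> in the kernel of \<open>Y\<close>, the rank-one matrix with entries
  \<open>u$r * v$q\<close> is tangent for every \<open>u\<close>, and the form at it is
  \<open>(u \<bullet> (S *v u)) * (v \<bullet> v)\<close>.\<close>

lemma psd_if_rank_deficient:
  fixes Y :: "real^'p::finite^('m::finite \<times> 'd::finite)"
  assumes S: "S \<in> sym_mats" and rank: "rank Y < CARD('p)"
    and nn: "\<And>Y'. Y' \<in> tangent_space Y \<Longrightarrow> 0 \<le> Y' \<bullet> (S ** Y')"
  shows "psd S"
proof -
  obtain v where v: "Y *v v = 0" "v \<noteq> 0"
    using rank less_rank_noninjective[of Y]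
      matrix_left_invertible_injective[of Y] matrix_left_invertible_ker[of Y] by blast
  have "0 \<le> u \<bullet> (S *v u)" for u
  proof -
    define Y' :: "real^'p^('m \<times> 'd)" where "Y' = (\<chi> r q. u$r * v$q)"
    have "Y' ** transpose Y = (\<chi> r s. u$r * (Y *v v)$s)"
      by (simp add: Y'_def matrix_matrix_mult_def matrix_vector_mult_def transpose_def vec_eq_iff
          sum_distrib_left ac_simps)
    then have z: "Y' ** transpose Y = 0" by (simp add: v vec_eq_iff)
    then have "Y ** transpose Y' = 0"
      by (metis matrix_transpose_mul transpose_transpose linear_0 linear_transpose)
    with z have "Y' \<in> tangent_space Y"
      by (simp add: tangent_space_def linear_0[OF linear_symblockdiag])
    then have "0 \<le> Y' \<bullet> (S ** Y')" by (rule nn)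
    moreover have "S ** Y' = (\<chi> r q. (S *v u)$r * v$q)"
      by (simp add: Y'_def matrix_matrix_mult_def matrix_vector_mult_def vec_eq_iff
          sum_distrib_left ac_simps)
    then have "Y' \<bullet> (S ** Y') = (\<Sum>r\<in>UNIV. \<Sum>q\<in>UNIV. (u$r * (S *v u)$r) * (v$q * v$q))"
      by (simp add: Y'_def inner_vec_def ac_simps)
    then have "Y' \<bullet> (S ** Y') = (u \<bullet> (S *v u)) * (v \<bullet> v)"
      by (simp add: inner_vec_def sum_product)
    moreover have "0 < v \<bullet> v" using v(2) by simp
    ultimately show ?thesis by (simp add: zero_le_mult_iff)
  qed
  then show ?thesis using S by (simp add: psd_def)
qed

lemma diag_mat_mult_vec_nth: "(diag_mat c *v w) $ i = c i * w $ i" for w :: "real^'n"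
  by (simp add: matrix_vector_mult_def diag_mat_def if_distribR if_distrib cong: if_cong)

lemma psd_if_no_neg_eigenvalues:
  assumes S: "S \<in> sym_mats" and z: "num_neg_eigenvalues S = 0"
  shows "psd S"
proof -
  obtain Q c where orth: "orthogonal_matrix Q" and Sd: "S = Q ** diag_mat c ** transpose Q"
    using real_spectral_theorem[OF S] by blast
  have "card {i. c i < 0} = 0"
    using z unfolding Sd num_neg_eigenvalues_spectral[OF orth] .
  then have c: "0 \<le> c i" for i by (auto simp: not_less)
  have "0 \<le> v \<bullet> (S *v v)" for v
  proof -
    let ?w = "transpose Q *v v"
    have "v \<bullet> (S *v v) = ?w \<bullet> (diag_mat c *v ?w)"
      unfolding Sd by (rule inner_transpose_self_mult)
    also have "\<dots> = (\<Sum>i\<in>UNIV. c i * (?w $ i * ?w $ i))"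
      by (simp add: inner_vec_def diag_mat_mult_vec_nth ac_simps)
    finally show ?thesis using c by (simp add: sum_nonneg)
  qed
  then show ?thesis using S by (simp add: psd_def)
qed

text \<open>The transpose of \<open>Y\<close> is surjective, so \<open>Y\<close> and its Gram matrix
  have the same range.\<close>

lemma rank_gram:
  fixes Y :: "real^'p^'n"
  assumes "rank Y = CARD('p)"
  shows "rank (Y ** transpose Y) = CARD('p)"
proof -
  have "surj ((*v) (transpose Y))"
    using assms full_rank_surjective[of "transpose Y"] by (simp add: rank_transpose)
  then have "range (\<lambda>v. (Y ** transpose Y) *v v) = range ((*v) Y)"
    by (auto simp: matrix_vector_mul_assoc[symmetric] image_iff surj_def) metis
  then show ?thesis using assms by (simp add: rank_dim_range)
qed

theorem theorem3p13:
  fixes f :: "real^('m::finite \<times> 'd::finite)^('m \<times> 'd) \<Rightarrow> real"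
    and Y :: "real^'p::finite^('m \<times> 'd)"
    and X S :: "real^('m \<times> 'd)^('m \<times> 'd)"
    and F :: "(real^('m \<times> 'd)^('m \<times> 'd)) set"
    and D :: real
  assumes "CARD('d) \<le> CARD('p)"
    and "CARD('p) \<le> CARD('m) * CARD('d)"
    and "twice_cont_diff_sym f"
    and "concave_on sym_mats f"
    and "Y \<in> stiefel"
    and "second_order_critical_point f Y"
    and "X = Y ** transpose Y"
    and "F = face_at feasible X"
    and "S = S_mat f X"
    and "D = Delta CARD('m) CARD('d) CARD('p)"
  shows "(rank Y < CARD('p) \<longrightarrow> psd S) \<and>
    (rank Y = CARD('p) \<longrightarrow>
       int (num_neg_eigenvalues S) \<le> \<lfloor>(real_of_int (aff_dim F) - D) / real CARD('p)\<rfloor>) \<and>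
    (\<not> KKT_point f X \<longrightarrow>
       rank X = CARD('p) \<and> real_of_int (aff_dim F) \<ge> D + real CARD('p))"
proof -
  let ?p = "CARD('p)"
  have Ssym: "S \<in> sym_mats"
    using S_mat_sym[OF assms(3), of X] gram_sym assms(7,9) by blast
  have SY: "S ** Y = 0"
    using assms(6,7,9) by (simp add: second_order_critical_point_def critical_point_def)
  have nn: "0 \<le> Y' \<bullet> (S ** Y')" if "Y' \<in> tangent_space Y" for Y'
    using second_order_imp_nonneg_on_tangent[OF assms(3,4,6) that] assms(7,9) by simp
  have X: "X \<in> feasible" using gram_feasible assms(5,7) by blast
  have F: "F face_of feasible" "X \<in> F"
    using face_at_works[OF convex_feasible X] rel_interior_subset assms(8) by blast+
  have deficient: "psd S" if "rank Y < ?p" using psd_if_rank_deficient[OF Ssym that nn] .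
  have full: "real (num_neg_eigenvalues S) * real ?p \<le> real_of_int (aff_dim F) - D"
    if rank: "rank Y = ?p"
  proof -
    define k where "k = dim {A \<in> sym_mats. symblockdiag (Y ** A ** transpose Y) = 0}"
    have k: "int k \<le> aff_dim F"
      using dim_constraint_kernel_le_aff_dim_face[OF assms(5) rank] F assms(7) by (simp add: k_def)
    have "2 * (num_neg_eigenvalues S * ?p) + ?p * (?p + 1)
        \<le> CARD('m) * (CARD('d) * (CARD('d) + 1)) + 2 * k"
      unfolding k_def by (rule negative_eigenvalues_dim_bound[OF Ssym SY nn])
    \<comment> \<open>The count passes to the reals here, since \<open>D\<close> involves a
      subtraction and may be negative.\<close>
    then have "real (2 * (num_neg_eigenvalues S * ?p) + ?p * (?p + 1))
        \<le> real (CARD('m) * (CARD('d) * (CARD('d) + 1)) + 2 * k)"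
      by (simp only: of_nat_le_iff)
    then have "2 * (real (num_neg_eigenvalues S) * real ?p) + real ?p * (real ?p + 1)
        \<le> real CARD('m) * (real CARD('d) * (real CARD('d) + 1)) + 2 * real k"
      by (simp only: of_nat_add of_nat_mult of_nat_1 of_nat_numeral)
    moreover have "2 * D = real ?p * (real ?p + 1) - real CARD('m) * (real CARD('d) * (real CARD('d) + 1))"
      by (simp add: assms(10) Delta_def)
    moreover have "real k \<le> real_of_int (aff_dim F)" using k by linarith
    ultimately show ?thesis by linarith
  qed
  \<comment> \<open>\<open>S\<close> itself is the dual certificate, with multiplier
    \<open>?L\<close>; complementarity \<open>S ** X = 0\<close> follows from
    \<open>S ** Y = 0\<close>.\<close>
  have "psd S \<Longrightarrow> KKT_point f X"
  proof -
    assume psd: "psd S"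
    let ?L = "- symblockdiag (grad f X ** X)"
    have "?L \<in> sym_mats"
      using symblockdiag_sym subspace_neg[OF subspace_sym_mats] by blast
    moreover have "block_diagonal ?L"
      using block_diagonal_symblockdiag[of "grad f X ** X"]
      by (simp add: block_diagonal_def block_def vec_eq_iff)
    moreover have "S ** X = 0"
      using SY linear_0[OF linear_matrix_mult_right] by (simp add: assms(7) matrix_mul_assoc)
    moreover have "S = grad f X + ?L" by (simp add: assms(9) S_mat_def)
    ultimately show "KKT_point f X"
      unfolding KKT_point_def using X Ssym psd by blast
  qed
  moreover have "rank Y \<le> ?p" using rank_bound[of Y] by simp
  \<comment> \<open>Without KKT, \<open>S\<close> is not positive semidefinite. This excludes both
    rank deficiency and the absence of negative eigenvalues.\<close>
  ultimately have nonKKT: "rank Y = ?p \<and> num_neg_eigenvalues S \<ge> 1" if "\<not> KKT_point f X"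
    using that deficient psd_if_no_neg_eigenvalues[OF Ssym] by linarith
  show ?thesis
  proof (intro conjI impI)
    show "psd S" if "rank Y < ?p" using deficient that .
    show "int (num_neg_eigenvalues S) \<le> \<lfloor>(real_of_int (aff_dim F) - D) / real ?p\<rfloor>"
      if "rank Y = ?p"
      using full[OF that] by (simp add: le_floor_iff pos_le_divide_eq)
    assume "\<not> KKT_point f X"
    then have r: "rank Y = ?p" and neg: "num_neg_eigenvalues S \<ge> 1" using nonKKT by auto
    show "rank X = ?p" using rank_gram[OF r] assms(7) by simp
    \<comment> \<open>A single negative eigenvalue already costs \<open>?p\<close> dimensions in
      \<open>full\<close>.\<close>
    have "1 * real ?p \<le> real (num_neg_eigenvalues S) * real ?p"
      using neg by (intro mult_right_mono) auto
    then show "D + real ?p \<le> real_of_int (aff_dim F)" using full[OF r] by linarith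
  qed
qed

end
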